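(* Let $\mathcal{F}$ be a union-closed family of finite sets with $\emptyset\in\mathcal{F}$, let $U\subseteq\bigcup\mathcal{F}$, and let $D$ be a finite set with $D\supseteq\bigcup\mathcal{F}$. There exists an extension $\mathcal{F}'=\mathcal{F}\vee\mathcal{H}$ of $(\mathcal{F},U)$ such that (i) $\mathcal{H}$ is a nonempty order filter (up-set) of the Boolean lattice $2^{D\setminus U}$; (ii) $\mathcal{F}'_{\setminus U}=\mathcal{H}$; (iii) $\mathcal{F}'$ minimizes $\mu$ in $D$.
   Context: For families $\mathcal{A},\mathcal{B}$ of sets, $\mathcal{A}\vee\mathcal{B}=\{A\cup B:A\in\mathcal{A},B\in\mathcal{B}\}$, and $\mathcal{A}_{\setminus Z}=\{A\setminus Z:A\in\mathcal{A}\}$. $\pi_{\mathcal{F}}(X)=\bigcup\{V\in\mathcal{F}:V\subseteq X\}$. A union-closed family $\mathcal{F}'$ is an extension of $(\mathcal{F},U)$ if $\mathcal{F}'=\mathcal{F}\vee\mathcal{H}$ for a nonempty union-closed family $\mathcal{H}$ with $(\bigcup\mathcal{H})\cap U=\emptyset$. For $X$ with $X\cap U=\emptyset$, $E(X)$ is the set of $Y\subseteq U$ with $\pi_{\mathcal{F}}(X\cup Y)\cap U=Y$ and $\pi_{\mathcal{F}}(X\cup Y)\supseteq\pi_{\mathcal{F}}(X\cup U)\setminus U$. For an extension $\mathcal{F}'$, $\mu_{\mathcal{F}'}=\sum_{X\in\mathcal{F}'_{\setminus U}}|E(X)|\,/\,|\mathcal{F}'_{\setminus U}|$. An extension $\mathcal{F}'$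 of $(\mathcal{F},U)$ minimizes $\mu$ in $D$ if $\bigcup\mathcal{F}'\subseteq D$ and $\mu_{\mathcal{F}'}\le\mu_{\mathcal{F}''}$ for every extension $\mathcal{F}''$ of $(\mathcal{F},U)$ with $\bigcup\mathcal{F}''\subseteq D$. *)

theory Defs
  imports Complex_Main
begin

definition union_closed :: "'a set set \<Rightarrow> bool" where
  "union_closed \<F> \<longleftrightarrow> (\<forall>A\<in>\<F>. \<forall>B\<in>\<F>. A \<union> B \<in> \<F>)"

definition family_join :: "'a set set \<Rightarrow> 'a set set \<Rightarrow> 'a set set" where
  "family_join \<A> \<B> = {A \<union> B |A B. A \<in> \<A> \<and> B \<in> \<B>}"

definition family_minus :: "'a set set \<Rightarrow> 'a set \<Rightarrow> 'a set set" where
  "family_minus \<A> Z = {A - Z |A. A \<in> \<A>}"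

definition proj :: "'a set set \<Rightarrow> 'a set \<Rightarrow> 'a set" where
  "proj \<F> X = \<Union>{V \<in> \<F>. V \<subseteq> X}"

definition extension_by :: "'a set set \<Rightarrow> 'a set \<Rightarrow> 'a set set \<Rightarrow> 'a set set \<Rightarrow> bool" where
  "extension_by \<F> U \<H> \<F>' \<longleftrightarrow>
     union_closed \<F>' \<and> \<H> \<noteq> {} \<and> union_closed \<H> \<and> \<Union>\<H> \<inter> U = {} \<and> \<F>' = family_join \<F> \<H>"

definition extension :: "'a set set \<Rightarrow> 'a set \<Rightarrow> 'a set set \<Rightarrow> bool" where
  "extension \<F> U \<F>' \<longleftrightarrow> (\<exists>\<H>. extension_by \<F> U \<H> \<F>')"

text \<open>The following is meaningful for \<open>X\<close> disjoint from \<open>U\<close>.  Members of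
  \<open>family_minus \<F>' U\<close>, over which \<open>mu\<close> sums, are always such.\<close>

definition E_sets :: "'a set set \<Rightarrow> 'a set \<Rightarrow> 'a set \<Rightarrow> 'a set set" where
  "E_sets \<F> U X =
     {Y. Y \<subseteq> U \<and> proj \<F> (X \<union> Y) \<inter> U = Y \<and> proj \<F> (X \<union> U) - U \<subseteq> proj \<F> (X \<union> Y)}"

text \<open>The average depends on the extension \<open>\<F>'\<close> only through its trace off \<open>U\<close>; the sets
  \<open>E_sets\<close> are taken with respect to the original family \<open>\<F>\<close>.\<close>

definition mu :: "'a set set \<Rightarrow> 'a set \<Rightarrow> 'a set set \<Rightarrow> real" where
  "mu \<F> U \<F>' =
     (\<Sum>X\<in>family_minus \<F>' U. real (card (E_sets \<F> U X))) / real (card (family_minus \<F>' U))"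

definition minimizes_mu :: "'a set set \<Rightarrow> 'a set \<Rightarrow> 'a set \<Rightarrow> 'a set set \<Rightarrow> bool" where
  "minimizes_mu \<F> U D \<F>' \<longleftrightarrow>
     extension \<F> U \<F>' \<and> \<Union>\<F>' \<subseteq> D \<and>
     (\<forall>\<F>''. extension \<F> U \<F>'' \<and> \<Union>\<F>'' \<subseteq> D \<longrightarrow> mu \<F> U \<F>' \<le> mu \<F> U \<F>'')"

definition order_filter_of_Pow :: "'a set \<Rightarrow> 'a set set \<Rightarrow> bool" where
  "order_filter_of_Pow S \<H> \<longleftrightarrow>
     \<H> \<subseteq> Pow S \<and> (\<forall>A\<in>\<H>. \<forall>B\<in>Pow S. A \<subseteq> B \<longrightarrow> B \<in> \<H>)"

end

theory Submission
  imports Defs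
begin

text \<open>
  The trace \<open>\<G> = family_minus \<F>' U\<close> of an extension is closed under joins with members of \<open>family_minus \<F> U\<close>,
  and \<open>\<mu>\<close> depends only on \<open>\<G>\<close>. Up-compress \<open>\<G>\<close> in direction \<open>i\<close>, replacing \<open>X\<close> by
  \<open>X \<union> {i}\<close> whenever the latter is not in \<open>\<G>\<close>. When \<open>X\<close> really moves, absorption of
  \<open>\<pi>(X \<union> {i} \<union> U) - U\<close> forces this set to lie in \<open>X\<close>, whence \<open>E(X \<union> {i}) = E(X)\<close>. So
  compression preserves the cardinality, the sum of the \<open>|E(X)|\<close> and the closure property,
  and iterating it ends in an up-set with the same average.
\<close>

section \<open>Absorbing families and the sets \<open>E_sets\<close>\<close>

text \<open>Every trace of an extension has this property, and a nonempty up-set of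
  \<open>Pow (D - U)\<close> with it is again a trace, so \<mu> may be minimized over absorbing
  families.\<close>

definition absorbs :: "'a set set \<Rightarrow> 'a set \<Rightarrow> 'a set set \<Rightarrow> bool" where
  "absorbs \<F> U \<G> \<longleftrightarrow> (\<forall>A\<in>\<F>. \<forall>X\<in>\<G>. (A - U) \<union> X \<in> \<G>)"

text \<open>A set of \<open>\<G>\<close> that contains \<open>i\<close> equals its own
  \<open>insert i X\<close>, so the test leaves it fixed.\<close>

definition compress :: "'a \<Rightarrow> 'a set set \<Rightarrow> 'a set \<Rightarrow> 'a set" where
  "compress i \<G> X = (if insert i X \<in> \<G> then X else insert i X)"

lemma Union_mem_union_closed:
  assumes "union_closed \<F>" "{} \<in> \<F>" "finite \<A>" "\<A> \<subseteq> \<F>"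
  shows "\<Union>\<A> \<in> \<F>"
  using assms(3,4)
  by (induction \<A> rule: finite_induct) (use assms(1,2) in \<open>auto simp: union_closed_def\<close>)

lemma proj_mem:
  assumes "union_closed \<F>" "{} \<in> \<F>" "finite \<F>"
  shows "proj \<F> X \<in> \<F>"
  unfolding proj_def by (rule Union_mem_union_closed) (use assms in auto)

text \<open>A member of \<open>\<F>\<close> inside \<open>Z \<union> Y\<close> with
  \<open>Y \<subseteq> U\<close> lies in \<open>proj \<F> (Z \<union> U)\<close>, so its part off
  \<open>U\<close> is already in \<open>X\<close>. Hence \<open>X\<close> and \<open>Z\<close> give
  the same projections, also for \<open>Y = U\<close>, and these determine
  \<open>E_sets\<close>.\<close>

lemma E_sets_eqI:
  assumes "X \<subseteq> Z" "Z \<inter> U = {}" "proj \<F> (Z \<union> U) - U \<subseteq> X"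
  shows "E_sets \<F> U Z = E_sets \<F> U X"
proof -
  have eq: "proj \<F> (Z \<union> Y) = proj \<F> (X \<union> Y)" if "Y \<subseteq> U" for Y
  proof -
    have "V \<subseteq> Z \<union> Y \<longleftrightarrow> V \<subseteq> X \<union> Y" if V: "V \<in> \<F>" for V
    proof
      assume "V \<subseteq> Z \<union> Y"
      moreover from this have "V - U \<subseteq> X"
        using assms(3) V \<open>Y \<subseteq> U\<close> unfolding proj_def by blast
      ultimately show "V \<subseteq> X \<union> Y"
        using assms(2) by blast
    qed (use assms(1) in auto)
    then have "{V \<in> \<F>. V \<subseteq> Z \<union> Y} = {V \<in> \<F>. V \<subseteq> X \<union> Y}"
      by blast
    then show ?thesis
      by (simp add: proj_def)
  qed
  show ?thesis
    using eq by (auto simp: E_sets_def)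
qed

section \<open>Up-compression\<close>

text \<open>The image lies in \<open>\<G>\<close> exactly when the set did not move, so a moved and
  a fixed set never collide; two moved sets both lack \<open>i\<close>, which can be removed
  again.\<close>

lemma inj_on_compress: "inj_on (compress i \<G>) \<G>"
proof (rule inj_onI)
  fix X Y assume XY: "X \<in> \<G>" "Y \<in> \<G>" and eq: "compress i \<G> X = compress i \<G> Y"
  have mem: "compress i \<G> Z \<in> \<G> \<longleftrightarrow> insert i Z \<in> \<G>" if "Z \<in> \<G>" for Z
    using that by (simp add: compress_def)
  show "X = Y"
  proof (cases "insert i X \<in> \<G>")
    case True
    then have "insert i Y \<in> \<G>"
      using mem XY eq by metis
    with True eq show ?thesis
      by (simp add: compress_def)
  next
    case False
    then have "insert i Y \<notin> \<G>"
      using mem XY eq by metis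
    with False have "i \<notin> X" "i \<notin> Y" "insert i X = insert i Y"
      using XY eq by (auto simp: compress_def insert_absorb)
    then show ?thesis
      by (simp add: insert_ident)
  qed
qed

text \<open>If \<open>X\<close> stays, absorption applies to \<open>X\<close> and to
  \<open>insert i X\<close>, so \<open>(A - U) \<union> X\<close> stays too. If \<open>X\<close>
  moves, it is enough that \<open>insert i Z\<close> is in the image for every \<open>Z\<close> in
  \<open>\<G>\<close>: it is either fixed or arises by moving \<open>Z\<close>.\<close>

lemma absorbs_compress:
  assumes "absorbs \<F> U \<G>"
  shows "absorbs \<F> U (compress i \<G> ` \<G>)"
proof -
  have stay: "Z \<in> compress i \<G> ` \<G>" if "Z \<in> \<G>" "insert i Z \<in> \<G>" for Z
    using that by (intro image_eqI[of _ _ Z]) (auto simp: compress_def)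
  have move: "insert i Z \<in> compress i \<G> ` \<G>" if "Z \<in> \<G>" for Z
  proof (cases "insert i Z \<in> \<G>")
    case True
    then show ?thesis by (intro stay) auto
  next
    case False
    with that show ?thesis by (intro image_eqI[of _ _ Z]) (auto simp: compress_def)
  qed
  show ?thesis
    unfolding absorbs_def
  proof (intro ballI)
    fix A Z assume A: "A \<in> \<F>" and "Z \<in> compress i \<G> ` \<G>"
    then obtain X where X: "X \<in> \<G>" "Z = compress i \<G> X" by blast
    have AX: "(A - U) \<union> X \<in> \<G>"
      using assms A X(1) by (auto simp: absorbs_def)
    show "(A - U) \<union> Z \<in> compress i \<G> ` \<G>"
    proof (cases "insert i X \<in> \<G>")
      case True
      then have "(A - U) \<union> insert i X \<in> \<G>"
        using assms A unfolding absorbs_def by blast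
      with AX stay[of "(A - U) \<union> X"] True X(2) show ?thesis
        by (simp add: compress_def)
    next
      case False
      with move[OF AX] X(2) show ?thesis
        by (simp add: compress_def)
    qed
  qed
qed

lemma E_sets_compress:
  assumes \<F>: "union_closed \<F>" "{} \<in> \<F>" "finite \<F>"
    and "absorbs \<F> U \<G>" "X \<in> \<G>" "X \<inter> U = {}" "i \<notin> U"
  shows "E_sets \<F> U (compress i \<G> X) = E_sets \<F> U X"
proof (cases "insert i X \<in> \<G>")
  case True
  then show ?thesis by (simp add: compress_def)
next
  case False
  define W where "W = proj \<F> (insert i X \<union> U) - U"
  have "W \<union> X \<in> \<G>"
    using assms(4,5) proj_mem[OF \<F>] by (auto simp: absorbs_def W_def)
  \<comment> \<open>With \<open>W\<close> inside \<open>insert i X\<close>, the set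
    \<open>W \<union> X\<close> would equal \<open>insert i X\<close> if \<open>i\<close> were in
    \<open>W\<close>.\<close>
  with False have "W \<union> X \<noteq> insert i X"
    by metis
  moreover have "W \<subseteq> insert i X"
    by (auto simp: W_def proj_def)
  ultimately have "W \<subseteq> X"
    by blast
  then have "E_sets \<F> U (insert i X) = E_sets \<F> U X"
    using assms(6,7) by (intro E_sets_eqI) (auto simp: W_def)
  with False show ?thesis
    by (simp add: compress_def)
qed

section \<open>Iterating compression to an up-set\<close>

lemma order_filter_of_PowI:
  assumes "finite S" "\<G> \<subseteq> Pow S" "\<And>X i. X \<in> \<G> \<Longrightarrow> i \<in> S \<Longrightarrow> insert i X \<in> \<G>"
  shows "order_filter_of_Pow S \<G>"
proof -
  have add: "A \<union> T \<in> \<G>" if "A \<in> \<G>" "finite T" "T \<subseteq> S" for A T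
    using that(2,3) by (induction T rule: finite_induct) (use assms(3) that(1) in auto)
  have "B \<in> \<G>" if "A \<in> \<G>" "B \<subseteq> S" "A \<subseteq> B" for A B
    using add[of A B] that assms(1) by (simp add: Un_absorb1 finite_subset)
  with assms(2) show ?thesis
    by (auto simp: order_filter_of_Pow_def)
qed

lemma ex_order_filter_same_sum:
  fixes \<F> \<G> :: "'a set set"
  assumes \<F>: "union_closed \<F>" "{} \<in> \<F>" "finite \<F>"
    and S: "finite S" "S \<inter> U = {}"
    and "\<G> \<subseteq> Pow S" "absorbs \<F> U \<G>"
  shows "\<exists>\<H>. order_filter_of_Pow S \<H> \<and> absorbs \<F> U \<H> \<and> card \<H> = card \<G> \<and>
    (\<Sum>X\<in>\<H>. real (card (E_sets \<F> U X))) = (\<Sum>X\<in>\<G>. real (card (E_sets \<F> U X)))"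
  using assms(6,7)
\<comment> \<open>The measure counts the elements of \<open>S\<close> missing from the members; a
  compression that moves some set lowers it.\<close>
proof (induction "\<Sum>X\<in>\<G>. card (S - X)" arbitrary: \<G> rule: less_induct)
  case less
  show ?case
  proof (cases "\<forall>X\<in>\<G>. \<forall>i\<in>S. insert i X \<in> \<G>")
    case True
    then show ?thesis
      using order_filter_of_PowI[OF S(1) less.prems(1)] less.prems(2) by blast
  next
    case False
    then obtain X i where X: "X \<in> \<G>" "i \<in> S" "insert i X \<notin> \<G>" by blast
    let ?c = "compress i \<G>"
    have "finite \<G>"
      using less.prems(1) S(1) by (simp add: finite_subset)
    have dec: "card (S - ?c Z) \<le> card (S - Z)" for Z
      using S(1) by (intro card_mono) (auto simp: compress_def)
    have "i \<notin> X"
      using X by (metis insert_absorb)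
    then have "card (S - ?c X) < card (S - X)"
      using X S(1) by (intro psubset_card_mono) (auto simp: compress_def)
    \<comment> \<open>No term grows and that of the moved \<open>X\<close> drops; injectivity then
      turns the left side into the measure of the compressed family.\<close>
    then have "(\<Sum>Z\<in>\<G>. card (S - ?c Z)) < (\<Sum>Z\<in>\<G>. card (S - Z))"
      using \<open>finite \<G>\<close> X(1) dec by (intro sum_strict_mono_ex1) auto
    then have "(\<Sum>Z\<in>?c ` \<G>. card (S - Z)) < (\<Sum>Z\<in>\<G>. card (S - Z))"
      by (simp add: sum.reindex[OF inj_on_compress])
    moreover have "?c ` \<G> \<subseteq> Pow S"
      using less.prems(1) X(2) by (auto simp: compress_def split: if_splits)
    ultimately obtain \<H> where \<H>: "order_filter_of_Pow S \<H>" "absorbs \<F> U \<H>"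
      "card \<H> = card (?c ` \<G>)" "(\<Sum>Z\<in>\<H>. real (card (E_sets \<F> U Z))) =
        (\<Sum>Z\<in>?c ` \<G>. real (card (E_sets \<F> U Z)))"
      using less.hyps absorbs_compress[OF less.prems(2)] by blast
    have "E_sets \<F> U (?c Z) = E_sets \<F> U Z" if "Z \<in> \<G>" for Z
      using that less.prems S(2) X(2) by (intro E_sets_compress[OF \<F>]) auto
    then have "(\<Sum>Z\<in>?c ` \<G>. real (card (E_sets \<F> U Z))) = (\<Sum>Z\<in>\<G>. real (card (E_sets \<F> U Z)))"
      by (simp add: sum.reindex[OF inj_on_compress])
    with \<H> show ?thesis
      by (auto simp: card_image[OF inj_on_compress])
  qed
qed

section \<open>Traces of extensions\<close>

text \<open>A member of \<open>\<F>\<close> merges into the part \<open>B\<close> of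
  \<open>B \<union> H\<close>, by union-closure of \<open>\<F>\<close>.\<close>

lemma absorbs_family_minus_extension:
  assumes "union_closed \<F>" "extension \<F> U \<F>'"
  shows "absorbs \<F> U (family_minus \<F>' U)"
proof -
  obtain \<H> where \<F>': "\<F>' = family_join \<F> \<H>"
    using assms(2) by (auto simp: extension_def extension_by_def)
  have "A \<union> X \<in> \<F>'" if A: "A \<in> \<F>" and "X \<in> \<F>'" for A X
  proof -
    obtain B H where "B \<in> \<F>" "H \<in> \<H>" "X = B \<union> H"
      using \<open>X \<in> \<F>'\<close> by (auto simp: \<F>' family_join_def)
    then have "A \<union> X = (A \<union> B) \<union> H" "A \<union> B \<in> \<F>"
      using A assms(1) by (auto simp: union_closed_def)
    with \<open>H \<in> \<H>\<close> show ?thesis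
      unfolding \<F>' family_join_def by blast
  qed
  then have closed: "A \<union> X - U \<in> family_minus \<F>' U" if "A \<in> \<F>" "X \<in> \<F>'" for A X
    using that unfolding family_minus_def by blast
  show ?thesis
    unfolding absorbs_def
  proof (intro ballI)
    fix A Z assume "A \<in> \<F>" "Z \<in> family_minus \<F>' U"
    then obtain X where "X \<in> \<F>'" "Z = X - U"
      by (auto simp: family_minus_def)
    with closed[OF \<open>A \<in> \<F>\<close>] show "(A - U) \<union> Z \<in> family_minus \<F>' U"
      by (simp add: Un_Diff)
  qed
qed

text \<open>Absorption keeps \<open>(A - U) \<union> H\<close> inside \<open>\<H>\<close>, and
  \<open>A = {}\<close> recovers every \<open>H\<close>.\<close>

lemma family_minus_family_join:
  assumes "{} \<in> \<F>" "absorbs \<F> U \<H>" "\<Union>\<H> \<inter> U = {}"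
  shows "family_minus (family_join \<F> \<H>) U = \<H>"
proof
  show "family_minus (family_join \<F> \<H>) U \<subseteq> \<H>"
  proof
    fix Z assume "Z \<in> family_minus (family_join \<F> \<H>) U"
    then obtain A H where AH: "A \<in> \<F>" "H \<in> \<H>" "Z = (A \<union> H) - U"
      by (auto simp: family_minus_def family_join_def)
    then have "Z = (A - U) \<union> H"
      using assms(3) by blast
    with AH assms(2) show "Z \<in> \<H>"
      unfolding absorbs_def by metis
  qed
  show "\<H> \<subseteq> family_minus (family_join \<F> \<H>) U"
  proof
    fix H assume "H \<in> \<H>"
    then have "H = ({} \<union> H) - U" "{} \<union> H \<in> family_join \<F> \<H>"
      using assms(1,3) unfolding family_join_def by blast+
    then show "H \<in> family_minus (family_join \<F> \<H>) U"
      unfolding family_minus_def by blast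
  qed
qed

lemma union_closed_family_join:
  assumes "union_closed \<A>" "union_closed \<B>"
  shows "union_closed (family_join \<A> \<B>)"
  unfolding union_closed_def
proof (intro ballI)
  fix X Y assume "X \<in> family_join \<A> \<B>" "Y \<in> family_join \<A> \<B>"
  then obtain A B A' B' where "A \<in> \<A>" "B \<in> \<B>" "X = A \<union> B" "A' \<in> \<A>" "B' \<in> \<B>" "Y = A' \<union> B'"
    by (auto simp: family_join_def)
  then have "X \<union> Y = (A \<union> A') \<union> (B \<union> B')" "A \<union> A' \<in> \<A>" "B \<union> B' \<in> \<B>"
    using assms by (auto simp: union_closed_def)
  then show "X \<union> Y \<in> family_join \<A> \<B>"
    unfolding family_join_def by blast
qed

theorem theorem3p13:
  fixes \<F> :: "'a set set" and U D :: "'a set"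
  assumes "union_closed \<F>"
    and "\<forall>A\<in>\<F>. finite A"
    and "{} \<in> \<F>"
    and "U \<subseteq> \<Union>\<F>"
    and "finite D"
    and "\<Union>\<F> \<subseteq> D"
  shows "\<exists>\<F>' \<H>. extension_by \<F> U \<H> \<F>' \<and>
           (\<H> \<noteq> {} \<and> order_filter_of_Pow (D - U) \<H>) \<and>
           family_minus \<F>' U = \<H> \<and>
           minimizes_mu \<F> U D \<F>'"
proof -
  let ?S = "D - U"
  define avg where "avg \<G> = (\<Sum>X\<in>\<G>. real (card (E_sets \<F> U X))) / real (card \<G>)" for \<G>
  \<comment> \<open>This finite class contains the traces of all competitors within
    \<open>D\<close>, and \<open>Pow ?S\<close> shows it nonempty, so a minimum of
    \<open>avg\<close> exists.\<close>
  define \<C> where "\<C> = {\<G>. \<G> \<noteq> {} \<and> \<G> \<subseteq> Pow ?S \<and> absorbs \<F> U \<G>}"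
  have fin: "finite \<F>" "finite ?S"
    using assms(5,6) by (auto intro: finite_subset[of _ "Pow D"])
  have "finite \<C>"
    using fin(2) by (auto simp: \<C>_def intro: finite_subset[of _ "Pow (Pow ?S)"])
  moreover have "Pow ?S \<in> \<C>"
    using assms(6) by (auto simp: \<C>_def absorbs_def)
  ultimately obtain \<G> where \<G>: "\<G> \<in> \<C>" and min: "\<And>\<K>. \<K> \<in> \<C> \<Longrightarrow> avg \<G> \<le> avg \<K>"
    using ex_is_arg_min_if_finite[of \<C> avg] by (force simp: is_arg_min_def not_less)
  obtain \<H> where \<H>: "order_filter_of_Pow ?S \<H>" "absorbs \<F> U \<H>" "card \<H> = card \<G>"
    and "(\<Sum>X\<in>\<H>. real (card (E_sets \<F> U X))) = (\<Sum>X\<in>\<G>. real (card (E_sets \<F> U X)))"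
    using ex_order_filter_same_sum[OF assms(1,3) fin, of U \<G>] \<G> by (auto simp: \<C>_def)
  then have avg: "avg \<H> = avg \<G>"
    by (simp add: avg_def)
  \<comment> \<open>An infinite set would have \<open>card\<close> 0; finiteness lets equal
    cardinalities carry nonemptiness over to \<open>\<H>\<close>.\<close>
  have "finite \<G>"
    using \<G> fin(2) by (auto simp: \<C>_def intro: finite_subset)
  then have ne: "\<H> \<noteq> {}"
    using \<G> \<H>(3) by (auto simp: \<C>_def)
  have sub: "\<H> \<subseteq> Pow ?S"
    using \<H>(1) by (simp add: order_filter_of_Pow_def)
  then have disj: "\<Union>\<H> \<inter> U = {}"
    by blast
  have "union_closed \<H>"
    unfolding union_closed_def
  proof (intro ballI)
    fix A B assume "A \<in> \<H>" "B \<in> \<H>"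
    then have "A \<union> B \<in> Pow ?S" "A \<subseteq> A \<union> B"
      using sub by blast+
    with \<open>A \<in> \<H>\<close> \<H>(1) show "A \<union> B \<in> \<H>"
      unfolding order_filter_of_Pow_def by blast
  qed
  define \<F>' where "\<F>' = family_join \<F> \<H>"
  have ext: "extension_by \<F> U \<H> \<F>'"
    using ne disj \<open>union_closed \<H>\<close> union_closed_family_join[OF assms(1)]
    by (simp add: extension_by_def \<F>'_def)
  have trace: "family_minus \<F>' U = \<H>"
    unfolding \<F>'_def using assms(3) \<H>(2) disj by (rule family_minus_family_join)
  have mu: "mu \<F> U \<K> = avg (family_minus \<K> U)" for \<K>
    by (simp add: mu_def avg_def)
  \<comment> \<open>The up-set attains the minimum over \<open>\<C>\<close>, and the trace of the
    competitor belongs to \<open>\<C>\<close>.\<close>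
  have "mu \<F> U \<F>' \<le> mu \<F> U \<K>" if "extension \<F> U \<K>" "\<Union>\<K> \<subseteq> D" for \<K>
  proof -
    have "\<K> \<noteq> {}"
      using that(1) assms(3) by (auto simp: extension_def extension_by_def family_join_def)
    then have "family_minus \<K> U \<in> \<C>"
      using absorbs_family_minus_extension[OF assms(1) that(1)] that(2)
      by (auto simp: \<C>_def family_minus_def)
    then show ?thesis
      using min by (simp add: mu trace avg)
  qed
  moreover have "\<Union>\<F>' \<subseteq> D"
    using assms(6) sub unfolding \<F>'_def family_join_def by blast
  ultimately have "minimizes_mu \<F> U D \<F>'"
    using ext by (auto simp: minimizes_mu_def extension_def)
  with ext ne \<H>(1) trace show ?thesis
    by blast
qed

end
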